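(* Let $\nu = e^{-f}$ on $\mathbb{R}^n$ be $(L,M)$-smooth and let $0 \le t \le \min\{\frac{1}{8L},\frac{1}{M}\}$. For $x\in\mathbb{R}^n$ define $G = G(x) = (I + t\nabla^2 f(x))^{-2}$ and \[ \tilde\mu(x) = -t\,\nabla^2 f(x)\,G\,\nabla f(x) - t\sqrt{G}\,\mathrm{Tr}(\nabla^3 f(x)\,G) - \nabla\cdot G. \] Then for all $x\in\mathbb{R}^n$, \[ \tfrac34 I \preceq G(x) \preceq \tfrac43 I \qquad\text{and}\qquad \|\tilde\mu(x)\| \le \tfrac43 tL\|\nabla f(x)\| + 6\,t\,n^{3/2} M. \]
   Context: $\nu=e^{-f}$ is $(L,M)$-smooth if $f$ is three times differentiable, $\|\nabla^2 f(x)\|_{\mathrm{op}} \le L$ for all $x$, and $\|\nabla^2 f(x) - \nabla^2 f(y)\|_{\mathrm{op}} \le M\|x-y\|$ for all $x,y$. $\sqrt{G}$ is the positive definite square root. $\mathrm{Tr}(\nabla^3 f(x)\,G)\in\mathbb{R}^n$ is the vector whose $i$-th component is $\mathrm{Tr}(\nabla_i\nabla^2 f(x)\,G)$, where $\nabla_i\nabla^2 f(x)$ is the matrix with $(j,k)$ entry $\frac{\partial^3 f(x)}{\partial x_i\partial x_j\partial x_k}$. For a matrix-valued function $G(x)$ (here with $t$ fixed), $\nabla\cdot G(x)\in\mathbb{R}^n$ is the vector whose $i$-th component is $\sum_{j=1}^n \frac{\partial G_{ij}(x)}{\partial x_j}$. *)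

theory Defs
  imports "HOL-Analysis.Analysis"
begin

text \<open>Partial derivative along the i-th coordinate axis.\<close>
definition partial :: "'n::finite \<Rightarrow> (real^'n \<Rightarrow> real) \<Rightarrow> real^'n \<Rightarrow> real" where
  "partial i g x = deriv (\<lambda>s. g (x + s *\<^sub>R axis i 1)) 0"

definition grad :: "(real^'n::finite \<Rightarrow> real) \<Rightarrow> real^'n \<Rightarrow> real^'n" where
  "grad f x = (\<chi> i. partial i f x)"

definition hess :: "(real^'n::finite \<Rightarrow> real) \<Rightarrow> real^'n \<Rightarrow> real^'n^'n" where
  "hess f x = (\<chi> i j. partial i (partial j f) x)"

text \<open>The matrix \<nabla>_i \<nabla>^2 f(x), with (j,k) entry the third partial derivative.\<close>
definition third :: "(real^'n::finite \<Rightarrow> real) \<Rightarrow> real^'n \<Rightarrow> 'n \<Rightarrow> real^'n^'n" where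
  "third f x i = (\<chi> j k. partial i (\<lambda>y. hess f y $ j $ k) x)"

text \<open>Three times (Frechet) differentiable on all of R^n.\<close>
definition thrice_differentiable :: "(real^'n::finite \<Rightarrow> real) \<Rightarrow> bool" where
  "thrice_differentiable f \<longleftrightarrow>
     (\<forall>x. f differentiable (at x)) \<and>
     (\<forall>j x. partial j f differentiable (at x)) \<and>
     (\<forall>j k x. partial j (partial k f) differentiable (at x))"

definition LM_smooth :: "(real^'n::finite \<Rightarrow> real) \<Rightarrow> real \<Rightarrow> real \<Rightarrow> bool" where
  "LM_smooth f L M \<longleftrightarrow> thrice_differentiable f \<and>
     (\<forall>x. onorm (\<lambda>v. hess f x *v v) \<le> L) \<and>
     (\<forall>x y. onorm (\<lambda>v. (hess f x - hess f y) *v v) \<le> M * norm (x - y))"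

text \<open>Loewner order: A \<preceq> B.\<close>
definition loewner_le :: "real^'n::finite^'n \<Rightarrow> real^'n^'n \<Rightarrow> bool" where
  "loewner_le A B \<longleftrightarrow> (\<forall>v. v \<bullet> (A *v v) \<le> v \<bullet> (B *v v))"

definition pos_def :: "real^'n::finite^'n \<Rightarrow> bool" where
  "pos_def S \<longleftrightarrow> transpose S = S \<and> (\<forall>v. v \<noteq> 0 \<longrightarrow> v \<bullet> (S *v v) > 0)"

text \<open>Positive definite square root.\<close>
definition pd_sqrt :: "real^'n::finite^'n \<Rightarrow> real^'n^'n" where
  "pd_sqrt G = (THE S. pos_def S \<and> S ** S = G)"

definition Gmat :: "(real^'n::finite \<Rightarrow> real) \<Rightarrow> real \<Rightarrow> real^'n \<Rightarrow> real^'n^'n" where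
  "Gmat f t x = matrix_inv (mat 1 + t *\<^sub>R hess f x) ** matrix_inv (mat 1 + t *\<^sub>R hess f x)"

text \<open>Divergence of a matrix field: i-th entry is sum_j d/dx_j G_ij.\<close>
definition mdiv :: "(real^'n::finite \<Rightarrow> real^'n^'n) \<Rightarrow> real^'n \<Rightarrow> real^'n" where
  "mdiv G x = (\<chi> i. \<Sum>j\<in>UNIV. partial j (\<lambda>y. G y $ i $ j) x)"

text \<open>Tr(\<nabla>^3 f(x) G) as a vector.\<close>
definition tr3 :: "(real^'n::finite \<Rightarrow> real) \<Rightarrow> real^'n \<Rightarrow> real^'n^'n \<Rightarrow> real^'n" where
  "tr3 f x G = (\<chi> i. trace (third f x i ** G))"

definition mu_tilde :: "(real^'n::finite \<Rightarrow> real) \<Rightarrow> real \<Rightarrow> real^'n \<Rightarrow> real^'n" where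
  "mu_tilde f t x =
     - (t *\<^sub>R (hess f x *v (Gmat f t x *v grad f x)))
     - t *\<^sub>R (pd_sqrt (Gmat f t x) *v tr3 f x (Gmat f t x))
     - mdiv (Gmat f t) x"

end

theory Submission
  imports Defs
begin

(* Put B = (I + t Hess f)^-1, so that G = B^2. Since t |Hess f| <= 1/8, B is symmetric positive
   definite with |v| * 8/9 <= |B v| <= |v| * 8/7; this gives both Loewner bounds and identifies
   sqrt G with B. Differentiating along a coordinate axis with the resolvent identity yields
   d_k B = - B (t d_k Hess f) B and d_k G = (d_k B) B + B (d_k B), and |d_k Hess f| <= M because
   the Hessian is M-Lipschitz. As div G = sum_k (d_k G) e_k with every term O(tM), the divergence
   is O(n t M); and |trace X| <= n |X| bounds every entry of the trace vector by O(n M), hence its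
   norm by O(n^(3/2) M). *)

lemma matrix_mul_diff_left: "(A::'a::comm_ring_1^'n^'m) ** (B - C) = A ** B - A ** C"
  by (simp add: matrix_matrix_mult_def vec_eq_iff sum_subtractf algebra_simps)

lemma matrix_mul_diff_right: "((A::'a::comm_ring_1^'n^'m) - B) ** C = A ** C - B ** C"
  by (simp add: matrix_matrix_mult_def vec_eq_iff sum_subtractf algebra_simps)

lemma matrix_mul_minus_left: "(- A::'a::comm_ring_1^'n^'m) ** B = - (A ** B)"
  by (simp add: matrix_matrix_mult_def vec_eq_iff sum_negf)

lemma matrix_mul_minus_right: "(A::'a::comm_ring_1^'n^'m) ** (- B) = - (A ** B)"
  by (simp add: matrix_matrix_mult_def vec_eq_iff sum_negf)

lemma transpose_add: "transpose (A + B) = transpose A + transpose (B::'a::semiring_1^'n^'m)"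
  by (simp add: transpose_def vec_eq_iff)

lemma matrix_vector_mult_axis: "((A::real^'n^'m) *v axis k 1) $ i = A $ i $ k"
  by (simp add: matrix_vector_mult_basis column_def)

lemma matrix_inv_left_right:
  assumes "invertible (A::real^'n^'n)"
  shows "A ** matrix_inv A = mat 1" and "matrix_inv A ** A = mat 1"
proof -
  have "A ** matrix_inv A = mat 1 \<and> matrix_inv A ** A = mat 1"
    unfolding matrix_inv_def using assms unfolding invertible_def by (rule someI_ex)
  then show "A ** matrix_inv A = mat 1" and "matrix_inv A ** A = mat 1" by auto
qed

lemma symmetric_matrix_inv:
  assumes "invertible (A::real^'n^'n)" and "transpose A = A"
  shows "transpose (matrix_inv A) = matrix_inv A"
proof -
  note inv = matrix_inv_left_right[OF assms(1)]
  have "transpose (matrix_inv A) ** A = mat 1"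
    using inv(1) matrix_transpose_mul[of A "matrix_inv A"] assms(2) by simp
  then show ?thesis
    by (metis inv(1) matrix_mul_assoc matrix_mul_lid matrix_mul_rid)
qed

lemma resolvent_identity:
  assumes "invertible (A::real^'n^'n)" and "invertible B"
  shows "matrix_inv B - matrix_inv A = matrix_inv B ** ((A - B) ** matrix_inv A)"
  by (simp add: matrix_mul_diff_left matrix_mul_diff_right matrix_mul_assoc
      matrix_inv_left_right[OF assms(1)] matrix_inv_left_right[OF assms(2)])

lemma onorm_matrix_nonneg: "0 \<le> onorm ((*v) (A::real^'n^'m))"
  by (rule onorm_pos_le) simp

lemma onorm_matrix_mul_le:
  "onorm ((*v) (A ** B)) \<le> onorm ((*v) A) * onorm ((*v) (B::real^'n^'m))"
  for A :: "real^'m^'k"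
proof -
  have "(*v) (A ** B) = (*v) A \<circ> (*v) B" by (simp add: fun_eq_iff matrix_vector_mul_assoc)
  then show ?thesis by (simp add: onorm_compose)
qed

lemma norm_matrix_vector_bound:
  "onorm ((*v) A) \<le> a \<Longrightarrow> norm (A *v v) \<le> a * norm v" for A :: "real^'n^'m"
  by (rule order_trans[OF onorm[OF matrix_vector_mul_bounded_linear] mult_right_mono]) simp_all

lemma onorm_matrix_mul_bound:
  fixes A :: "real^'m^'k" and B :: "real^'n^'m"
  assumes "onorm ((*v) A) \<le> a" and "onorm ((*v) B) \<le> b"
  shows "onorm ((*v) (A ** B)) \<le> a * b"
proof -
  have "onorm ((*v) (A ** B)) \<le> onorm ((*v) A) * onorm ((*v) B)"
    by (rule onorm_matrix_mul_le)
  also have "\<dots> \<le> a * b"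
    using assms onorm_matrix_nonneg[of A] onorm_matrix_nonneg[of B] by (intro mult_mono) auto
  finally show ?thesis .
qed

lemma onorm_matrix_uminus: "onorm ((*v) (- A)) = onorm ((*v) (A::real^'n^'m))"
proof -
  have "(*v) (- A) = (\<lambda>v. - (A *v v))"
    by (simp add: fun_eq_iff matrix_vector_mult_def vec_eq_iff sum_negf)
  then show ?thesis by (simp add: onorm_neg)
qed

lemma onorm_matrix_add_le:
  "onorm ((*v) (A + B)) \<le> onorm ((*v) A) + onorm ((*v) (B::real^'n^'m))"
proof -
  have "(*v) (A + B) = (\<lambda>v. A *v v + B *v v)"
    by (simp add: fun_eq_iff matrix_vector_mult_add_rdistrib)
  then show ?thesis by (simp add: onorm_triangle)
qed

lemma onorm_matrix_scaleR: "onorm ((*v) (c *\<^sub>R A)) = \<bar>c\<bar> * onorm ((*v) (A::real^'n^'m))"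
proof -
  have "(*v) (c *\<^sub>R A) = (\<lambda>v. c *\<^sub>R (A *v v))"
    by (simp add: fun_eq_iff scaleR_matrix_vector_assoc)
  then show ?thesis by (simp add: onorm_scaleR)
qed

lemma abs_trace_le_onorm: "\<bar>trace A\<bar> \<le> real CARD('n) * onorm ((*v) (A::real^'n^'n))"
proof -
  have "\<bar>trace A\<bar> \<le> (\<Sum>k\<in>UNIV. \<bar>A $ k $ k\<bar>)"
    unfolding trace_def by (rule sum_abs)
  also have "\<dots> \<le> (\<Sum>k\<in>(UNIV::'n set). onorm ((*v) A))"
    by (intro sum_mono matrix_component_le_onorm)
  finally show ?thesis by simp
qed

lemma norm_le_sqrt_card_if_components_le:
  fixes x :: "real^'n"
  assumes "\<And>i. \<bar>x $ i\<bar> \<le> c"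
  shows "norm x \<le> sqrt (real CARD('n)) * c"
proof -
  have "norm x = sqrt (\<Sum>i\<in>UNIV. (x $ i)\<^sup>2)" by (simp add: norm_vec_def L2_set_def)
  also have "\<dots> \<le> sqrt (\<Sum>i\<in>(UNIV::'n set). c\<^sup>2)"
    using power_mono[OF assms abs_ge_zero, of _ 2] by (intro real_sqrt_le_mono sum_mono) simp
  also have "\<dots> = sqrt (real CARD('n)) * c"
    using order_trans[OF abs_ge_zero assms] by (simp add: real_sqrt_mult)
  finally show ?thesis .
qed

lemma quadratic_form_scalar_matrix: "v \<bullet> ((c *\<^sub>R mat 1) *v v) = c * (norm v)\<^sup>2"
  for v :: "real^'n"
  by (simp add: scaleR_matrix_vector_assoc[symmetric] power2_norm_eq_inner)

lemma quadratic_form_square_symmetric: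
  assumes "transpose B = (B::real^'n^'n)"
  shows "v \<bullet> ((B ** B) *v v) = (norm (B *v v))\<^sup>2"
proof -
  have "v \<bullet> ((B ** B) *v v) = (v v* B) \<bullet> (B *v v)"
    by (simp add: matrix_vector_mul_assoc[symmetric] dot_lmul_matrix)
  also have "v v* B = B *v v"
    using transpose_matrix_vector[of B v] assms by simp
  finally show ?thesis by (simp add: power2_norm_eq_inner)
qed

context
  fixes E :: "real^'n^'n" and e :: real
  assumes onorm_E: "onorm ((*v) E) \<le> e" and e_lt_1: "e < 1"
begin

lemma norm_perturbed_identity_ge: "(1 - e) * norm v \<le> norm ((mat 1 + E) *v v)"
  using norm_matrix_vector_bound[OF onorm_E, of v] norm_triangle_ineq2[of v "- (E *v v)"]
  by (simp add: matrix_vector_mult_add_rdistrib algebra_simps)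

lemma norm_perturbed_identity_le: "norm ((mat 1 + E) *v v) \<le> (1 + e) * norm v"
  using norm_matrix_vector_bound[OF onorm_E, of v] norm_triangle_ineq[of v "E *v v"]
  by (simp add: matrix_vector_mult_add_rdistrib algebra_simps)

lemma invertible_perturbed_identity: "invertible (mat 1 + E)"
proof -
  have "inj ((*v) (mat 1 + E))"
  proof (rule injI)
    fix x y assume "(mat 1 + E) *v x = (mat 1 + E) *v y"
    then have "(mat 1 + E) *v (x - y) = 0" by (simp add: matrix_vector_mult_diff_distrib)
    then show "x = y" using norm_perturbed_identity_ge[of "x - y"] e_lt_1
      by (simp add: mult_le_0_iff)
  qed
  then show ?thesis
    using matrix_left_invertible_injective invertible_left_inverse by blast
qed

lemma perturbed_identity_inv_cancel: "(mat 1 + E) *v (matrix_inv (mat 1 + E) *v v) = v"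
  by (simp add: matrix_vector_mul_assoc matrix_inv_left_right invertible_perturbed_identity)

lemma onorm_inv_perturbed_identity: "onorm ((*v) (matrix_inv (mat 1 + E))) \<le> 1 / (1 - e)"
proof (rule onorm_le)
  fix v
  have "(1 - e) * norm (matrix_inv (mat 1 + E) *v v) \<le> norm v"
    using norm_perturbed_identity_ge[of "matrix_inv (mat 1 + E) *v v"]
    by (simp add: perturbed_identity_inv_cancel)
  then show "norm (matrix_inv (mat 1 + E) *v v) \<le> 1 / (1 - e) * norm v"
    using e_lt_1 by (simp add: field_simps)
qed

lemma norm_le_inv_perturbed_identity: "norm v \<le> (1 + e) * norm (matrix_inv (mat 1 + E) *v v)"
  using norm_perturbed_identity_le[of "matrix_inv (mat 1 + E) *v v"]
  by (simp add: perturbed_identity_inv_cancel)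

lemma pos_def_inv_perturbed_identity:
  assumes "transpose E = E"
  shows "pos_def (matrix_inv (mat 1 + E))"
  unfolding pos_def_def
proof (intro conjI allI impI)
  show "transpose (matrix_inv (mat 1 + E)) = matrix_inv (mat 1 + E)"
    by (rule symmetric_matrix_inv) (simp_all add: invertible_perturbed_identity transpose_add assms)
  fix v :: "real^'n" assume "v \<noteq> 0"
  define w where "w = matrix_inv (mat 1 + E) *v v"
  have v: "v = w + E *v w"
    using perturbed_identity_inv_cancel[of v] by (simp add: w_def matrix_vector_mult_add_rdistrib)
  with \<open>v \<noteq> 0\<close> have "w \<noteq> 0" by auto
  have "\<bar>(E *v w) \<bullet> w\<bar> \<le> e * norm w * norm w"
    using norm_matrix_vector_bound[OF onorm_E, of w]
    by (meson Cauchy_Schwarz_ineq2 mult_right_mono norm_ge_zero order_trans)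
  moreover have "0 < (1 - e) * (norm w * norm w)"
    using \<open>w \<noteq> 0\<close> e_lt_1 by simp
  ultimately have "0 < w \<bullet> w + (E *v w) \<bullet> w"
    by (simp add: algebra_simps dot_square_norm power2_eq_square)
  also have "\<dots> = v \<bullet> w"
    by (subst v) (simp add: inner_add_left inner_add_right inner_commute)
  finally show "0 < v \<bullet> (matrix_inv (mat 1 + E) *v v)"
    by (simp add: w_def)
qed

end

lemma quadratic_form_trace:
  fixes D X :: "real^'n^'n"
  assumes "transpose D = D"
  shows "trace (D ** (X ** D)) = (\<Sum>k\<in>UNIV. (D *v axis k 1) \<bullet> (X *v (D *v axis k 1)))"
proof -
  have "(D ** (X ** D)) $ k $ k = (D *v axis k 1) \<bullet> (X *v (D *v axis k 1))" for k
  proof -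
    have "(D ** (X ** D)) $ k $ k = axis k 1 \<bullet> (D *v (X *v (D *v axis k 1)))"
      by (simp add: inner_axis' matrix_vector_mult_axis matrix_vector_mul_assoc)
    also have "\<dots> = (axis k 1 v* D) \<bullet> (X *v (D *v axis k 1))" by (simp add: dot_lmul_matrix)
    also have "axis k 1 v* D = D *v axis k 1"
      using transpose_matrix_vector[of D "axis k 1"] assms by simp
    finally show ?thesis .
  qed
  then show ?thesis by (simp add: trace_def)
qed

lemma pos_def_quadratic_nonneg: "pos_def S \<Longrightarrow> 0 \<le> v \<bullet> (S *v v)"
  unfolding pos_def_def by (cases "v = 0") (auto intro: less_imp_le)

text \<open>If \<open>S\<^sup>2 = R\<^sup>2\<close> then \<open>D = S - R\<close> satisfies \<open>S D + D R = 0\<close>; taking the trace of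
  \<open>D (S D + D R)\<close> writes \<open>0\<close> as a sum of the nonnegative quadratic forms of \<open>S\<close> and \<open>R\<close>
  evaluated at the columns of \<open>D\<close>, which forces \<open>D = 0\<close>.\<close>
lemma pos_def_square_inj:
  fixes S R :: "real^'n^'n"
  assumes S: "pos_def S" and R: "pos_def R" and eq: "S ** S = R ** R"
  shows "S = R"
proof -
  define D where "D = S - R"
  define q where "q X = (\<Sum>k\<in>UNIV. (D *v axis k 1) \<bullet> (X *v (D *v axis k 1)))" for X
  have D_sym: "transpose D = D"
    using S R by (simp add: pos_def_def D_def transpose_def vec_eq_iff)
  have "S ** D + D ** R = 0"
    using eq by (simp add: D_def matrix_mul_diff_left matrix_mul_diff_right)
  then have "D ** (S ** D) + D ** (D ** R) = 0"
    by (metis matrix_add_ldistrib times0_right)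
  then have "trace (D ** (S ** D)) + trace (D ** (R ** D)) = 0"
    by (metis trace_add trace_0 mat_0 matrix_mul_assoc trace_mul_sym)
  then have "q S + q R = 0"
    by (simp add: q_def quadratic_form_trace[OF D_sym])
  moreover have "0 \<le> q S" "0 \<le> q R"
    unfolding q_def by (simp_all add: sum_nonneg pos_def_quadratic_nonneg S R)
  ultimately have "q S = 0" by linarith
  then have "(D *v axis k 1) \<bullet> (S *v (D *v axis k 1)) = 0" for k
    using sum_nonneg_eq_0_iff[of UNIV "\<lambda>k. (D *v axis k 1) \<bullet> (S *v (D *v axis k 1))"]
      pos_def_quadratic_nonneg[OF S] by (simp add: q_def)
  then have "D *v axis k 1 = 0" for k
    using S unfolding pos_def_def by force
  then have "D = 0" by (simp add: vec_eq_iff matrix_vector_mult_axis[symmetric])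
  then show ?thesis by (simp add: D_def)
qed

lemma pd_sqrt_square: "pos_def B \<Longrightarrow> pd_sqrt (B ** B) = B"
  unfolding pd_sqrt_def by (rule the_equality) (auto intro: pos_def_square_inj)

lemma tendsto_matrix_vector_mult:
  fixes X :: "'a \<Rightarrow> real^'n^'m"
  assumes "(X \<longlongrightarrow> A) F"
  shows "((\<lambda>s. X s *v v) \<longlongrightarrow> A *v v) F"
  unfolding matrix_vector_mult_def
  by (rule vec_tendstoI) (simp, intro tendsto_intros assms)

lemma tendsto_matrix_mult:
  fixes X :: "'a \<Rightarrow> real^'n^'m" and Y :: "'a \<Rightarrow> real^'k^'n"
  assumes "(X \<longlongrightarrow> A) F" and "(Y \<longlongrightarrow> B) F"
  shows "((\<lambda>s. X s ** Y s) \<longlongrightarrow> A ** B) F"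
  unfolding matrix_matrix_mult_def
  by (rule vec_tendstoI, rule vec_tendstoI) (simp, intro tendsto_intros assms)

lemma has_real_derivative_along_line:
  fixes g :: "real^'n \<Rightarrow> real"
  assumes "(g has_derivative D) (at (y + s0 *\<^sub>R e))"
  shows "((\<lambda>s. g (y + s *\<^sub>R e)) has_real_derivative D e) (at s0)"
proof -
  interpret D: bounded_linear D using assms by (rule has_derivative_bounded_linear)
  have "((\<lambda>s. y + s *\<^sub>R e) has_derivative (\<lambda>h. h *\<^sub>R e)) (at s0)"
    by (auto intro!: derivative_eq_intros)
  from has_derivative_compose[OF this assms]
  have "((\<lambda>s. g (y + s *\<^sub>R e)) has_derivative (\<lambda>h. D (h *\<^sub>R e))) (at s0)" .
  moreover have "(\<lambda>h. D (h *\<^sub>R e)) = (*) (D e)"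
    by (auto simp: D.scaleR mult.commute)
  ultimately show ?thesis by (simp add: has_field_derivative_def)
qed

lemma partial_eq_derivative:
  fixes g :: "real^'n \<Rightarrow> real"
  assumes "(g has_derivative D) (at x)"
  shows "partial i g x = D (axis i 1)"
  unfolding partial_def
  by (rule DERIV_imp_deriv, rule has_real_derivative_along_line) (use assms in simp)

lemma has_real_derivative_partial:
  fixes g :: "real^'n \<Rightarrow> real"
  assumes "g differentiable (at (y + s0 *\<^sub>R axis i 1))"
  shows "((\<lambda>s. g (y + s *\<^sub>R axis i 1)) has_real_derivative partial i g (y + s0 *\<^sub>R axis i 1)) (at s0)"
proof -
  obtain D where "(g has_derivative D) (at (y + s0 *\<^sub>R axis i 1))"
    using assms differentiable_def by blast
  then show ?thesis
    using has_real_derivative_along_line partial_eq_derivative by fastforce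
qed

lemma partial_entry_eq_limit:
  fixes X :: "real^'n \<Rightarrow> real^'m^'k"
  assumes "((\<lambda>s. (1/s) *\<^sub>R (X (x + s *\<^sub>R axis i 1) - X x)) \<longlongrightarrow> D) (at 0)"
  shows "partial i (\<lambda>y. X y $ a $ b) x = D $ a $ b"
proof -
  have "((\<lambda>s. (X (x + s *\<^sub>R axis i 1) $ a $ b - X x $ a $ b) / (s - 0)) \<longlongrightarrow> D $ a $ b) (at 0)"
    using tendsto_vec_nth[OF tendsto_vec_nth[OF assms], of a b] by simp
  then have "((\<lambda>s. X (x + s *\<^sub>R axis i 1) $ a $ b) has_real_derivative D $ a $ b) (at 0)"
    by (simp add: has_field_derivative_iff)
  then show ?thesis unfolding partial_def by (rule DERIV_imp_deriv)
qed

lemma tendsto_of_difference_quotient: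
  fixes X :: "real \<Rightarrow> 'a::real_normed_vector"
  assumes "((\<lambda>s. (1/s) *\<^sub>R (X s - c)) \<longlongrightarrow> D) (at 0)"
  shows "(X \<longlongrightarrow> c) (at 0)"
proof -
  have "((\<lambda>s. c + s *\<^sub>R ((1/s) *\<^sub>R (X s - c))) \<longlongrightarrow> c + 0 *\<^sub>R D) (at 0)"
    by (intro tendsto_intros tendsto_ident_at assms)
  moreover have "eventually (\<lambda>s. c + s *\<^sub>R ((1/s) *\<^sub>R (X s - c)) = X s) (at 0)"
    by (simp add: eventually_at_filter)
  ultimately show ?thesis by (simp add: Lim_transform_eventually)
qed

lemma second_difference_mean_value:
  fixes f :: "real^'n \<Rightarrow> real"
  assumes "\<And>y. f differentiable (at y)" and "0 < h"
  obtains \<xi> where "0 < \<xi>" "\<xi> < h"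
    "f (x + h *\<^sub>R d + h *\<^sub>R axis i 1) - f (x + h *\<^sub>R axis i 1) - f (x + h *\<^sub>R d) + f x
       = h * (partial i f (x + h *\<^sub>R d + \<xi> *\<^sub>R axis i 1) - partial i f (x + \<xi> *\<^sub>R axis i 1))"
proof -
  define \<phi> where "\<phi> s = f (x + h *\<^sub>R d + s *\<^sub>R axis i 1) - f (x + s *\<^sub>R axis i 1)" for s
  have "DERIV \<phi> s :> partial i f (x + h *\<^sub>R d + s *\<^sub>R axis i 1) - partial i f (x + s *\<^sub>R axis i 1)" for s
    unfolding \<phi>_def by (intro DERIV_diff has_real_derivative_partial assms(1))
  then obtain \<xi> where "0 < \<xi>" "\<xi> < h"
    and "\<phi> h - \<phi> 0
      = h * (partial i f (x + h *\<^sub>R d + \<xi> *\<^sub>R axis i 1) - partial i f (x + \<xi> *\<^sub>R axis i 1))"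
    using MVT2[of 0 h \<phi> "\<lambda>s. partial i f (x + h *\<^sub>R d + s *\<^sub>R axis i 1) - partial i f (x + s *\<^sub>R axis i 1)"]
      assms(2) by auto
  then show ?thesis by (intro that) (simp_all add: \<phi>_def algebra_simps)
qed

text \<open>By the mean value theorem \<open>\<Delta>(h) = h (g(x+hd+\<xi>e) - g(x+\<xi>e))\<close> with \<open>g = \<partial>\<^sub>i f\<close>;
  differentiability of \<open>g\<close> at \<open>x\<close> then makes \<open>\<Delta>(h)/h\<^sup>2\<close> converge to \<open>Dg(d)\<close>.\<close>
lemma second_difference_tendsto:
  fixes f :: "real^'n \<Rightarrow> real"
  assumes f: "\<And>y. f differentiable (at y)" and g: "partial i f differentiable (at x)"
  shows "((\<lambda>h. (f (x + h *\<^sub>R axis j 1 + h *\<^sub>R axis i 1) - f (x + h *\<^sub>R axis i 1)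
              - f (x + h *\<^sub>R axis j 1) + f x) / h\<^sup>2) \<longlongrightarrow> partial j (partial i f) x) (at_right 0)"
proof (rule tendstoI)
  define g where "g = partial i f"
  define e :: "real^'n" where "e = axis i 1"
  define d :: "real^'n" where "d = axis j 1"
  obtain Dg where Dg: "(g has_derivative Dg) (at x)"
    using g differentiable_def g_def by blast
  interpret Dg: bounded_linear Dg using Dg by (rule has_derivative_bounded_linear)
  fix \<epsilon> :: real assume "0 < \<epsilon>"
  then obtain \<delta> where "\<delta> > 0"
    and approx: "\<And>y. norm (y - x) < \<delta> \<Longrightarrow> \<bar>g y - g x - Dg (y - x)\<bar> \<le> \<epsilon>/4 * norm (y - x)"
    using Dg unfolding has_derivative_at_alt by (metis real_norm_def zero_less_divide_iff zero_less_numeral)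
  show "\<forall>\<^sub>F h in at_right 0. dist ((f (x + h *\<^sub>R axis j 1 + h *\<^sub>R axis i 1) - f (x + h *\<^sub>R axis i 1)
          - f (x + h *\<^sub>R axis j 1) + f x) / h\<^sup>2) (partial j (partial i f) x) < \<epsilon>"
    unfolding eventually_at_right_field
  proof (intro exI[of _ "\<delta>/2"] conjI allI impI)
    show "0 < \<delta>/2" using \<open>\<delta> > 0\<close> by simp
    fix h :: real assume "0 < h" "h < \<delta>/2"
    then obtain \<xi> where "0 < \<xi>" "\<xi> < h"
      and mvt: "f (x + h *\<^sub>R axis j 1 + h *\<^sub>R axis i 1) - f (x + h *\<^sub>R axis i 1)
        - f (x + h *\<^sub>R axis j 1) + f x = h * (g (x + h *\<^sub>R d + \<xi> *\<^sub>R e) - g (x + \<xi> *\<^sub>R e))"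
      using second_difference_mean_value[OF f, of h x "axis j 1" i] by (auto simp: g_def d_def e_def)
    have "norm (h *\<^sub>R d + \<xi> *\<^sub>R e) \<le> h + \<xi>"
      using norm_triangle_ineq[of "h *\<^sub>R d" "\<xi> *\<^sub>R e"] \<open>0 < h\<close> \<open>0 < \<xi>\<close> by (simp add: d_def e_def)
    then have "\<bar>g (x + h *\<^sub>R d + \<xi> *\<^sub>R e) - g x - Dg (h *\<^sub>R d + \<xi> *\<^sub>R e)\<bar> \<le> \<epsilon>/4 * (h + \<xi>)"
      using approx[of "x + h *\<^sub>R d + \<xi> *\<^sub>R e"] \<open>h < \<delta>/2\<close> \<open>\<xi> < h\<close> \<open>0 < \<epsilon>\<close>
      by (simp add: add.assoc) (meson mult_left_mono order_trans less_imp_le zero_le_divide_iff zero_le_numeral)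
    moreover have "\<bar>g (x + \<xi> *\<^sub>R e) - g x - Dg (\<xi> *\<^sub>R e)\<bar> \<le> \<epsilon>/4 * \<xi>"
      using approx[of "x + \<xi> *\<^sub>R e"] \<open>0 < \<xi>\<close> \<open>\<xi> < h\<close> \<open>h < \<delta>/2\<close> by (simp add: e_def)
    moreover have "Dg (h *\<^sub>R d + \<xi> *\<^sub>R e) - Dg (\<xi> *\<^sub>R e) = h * Dg d"
      by (simp add: Dg.add Dg.scaleR)
    moreover have "\<epsilon> * \<xi> < \<epsilon> * h" using \<open>\<xi> < h\<close> \<open>0 < \<epsilon>\<close> by simp
    ultimately have "\<bar>(g (x + h *\<^sub>R d + \<xi> *\<^sub>R e) - g (x + \<xi> *\<^sub>R e)) - h * Dg d\<bar> < \<epsilon> * h"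
      unfolding abs_le_iff abs_less_iff by (simp add: algebra_simps)
    moreover have "partial j (partial i f) x = Dg d"
      using partial_eq_derivative[OF Dg] by (simp add: g_def d_def)
    ultimately show "dist ((f (x + h *\<^sub>R axis j 1 + h *\<^sub>R axis i 1) - f (x + h *\<^sub>R axis i 1)
          - f (x + h *\<^sub>R axis j 1) + f x) / h\<^sup>2) (partial j (partial i f) x) < \<epsilon>"
      using \<open>0 < h\<close> mvt
      by (simp add: dist_real_def power2_eq_square) (auto simp: abs_less_iff field_simps)
  qed
qed

lemma partial_commute:
  fixes f :: "real^'n \<Rightarrow> real"
  assumes "\<And>y. f differentiable (at y)"
    and "partial i f differentiable (at x)" and "partial j f differentiable (at x)"
  shows "partial j (partial i f) x = partial i (partial j f) x"
proof (rule tendsto_unique[OF trivial_limit_at_right_real])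
  show "((\<lambda>h. (f (x + h *\<^sub>R axis j 1 + h *\<^sub>R axis i 1) - f (x + h *\<^sub>R axis i 1)
           - f (x + h *\<^sub>R axis j 1) + f x) / h\<^sup>2) \<longlongrightarrow> partial j (partial i f) x) (at_right 0)"
    by (rule second_difference_tendsto) (use assms in auto)
  have "((\<lambda>h. (f (x + h *\<^sub>R axis i 1 + h *\<^sub>R axis j 1) - f (x + h *\<^sub>R axis j 1)
           - f (x + h *\<^sub>R axis i 1) + f x) / h\<^sup>2) \<longlongrightarrow> partial i (partial j f) x) (at_right 0)"
    by (rule second_difference_tendsto) (use assms in auto)
  then show "((\<lambda>h. (f (x + h *\<^sub>R axis j 1 + h *\<^sub>R axis i 1) - f (x + h *\<^sub>R axis i 1)
           - f (x + h *\<^sub>R axis j 1) + f x) / h\<^sup>2) \<longlongrightarrow> partial i (partial j f) x) (at_right 0)"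
    by (simp add: add_ac diff_diff_eq)
qed

lemma transpose_hess:
  "thrice_differentiable f \<Longrightarrow> transpose (hess f y) = hess f y"
  unfolding thrice_differentiable_def
  by (simp add: transpose_def hess_def vec_eq_iff partial_commute)

lemma hess_difference_quotient_tendsto:
  assumes "thrice_differentiable f"
  shows "((\<lambda>s. (1/s) *\<^sub>R (hess f (x + s *\<^sub>R axis i 1) - hess f x)) \<longlongrightarrow> third f x i) (at 0)"
proof (rule vec_tendstoI, rule vec_tendstoI)
  fix j k
  have "(\<lambda>y. hess f y $ j $ k) = partial j (partial k f)" by (simp add: hess_def fun_eq_iff)
  then have "((\<lambda>s. hess f (x + s *\<^sub>R axis i 1) $ j $ k) has_real_derivative third f x i $ j $ k) (at 0)"
    using has_real_derivative_partial[of "\<lambda>y. hess f y $ j $ k" x 0 i] assms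
    by (simp add: third_def thrice_differentiable_def)
  then show "((\<lambda>s. ((1/s) *\<^sub>R (hess f (x + s *\<^sub>R axis i 1) - hess f x)) $ j $ k)
      \<longlongrightarrow> third f x i $ j $ k) (at 0)"
    by (simp add: has_field_derivative_iff)
qed

lemma onorm_third_le:
  assumes "LM_smooth f L M"
  shows "onorm ((*v) (third f x i)) \<le> M"
proof (rule onorm_le)
  fix v
  let ?Q = "\<lambda>s. (1/s) *\<^sub>R (hess f (x + s *\<^sub>R axis i 1) - hess f x)"
  have "((\<lambda>s. ?Q s *v v) \<longlongrightarrow> third f x i *v v) (at 0)"
    using assms hess_difference_quotient_tendsto[of f x i] unfolding LM_smooth_def
    by (auto intro: tendsto_matrix_vector_mult)
  moreover have "eventually (\<lambda>s. norm (?Q s *v v) \<le> M * norm v) (at 0)"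
    unfolding eventually_at_filter
  proof (intro always_eventually allI impI)
    fix s :: real assume "s \<noteq> 0"
    have "onorm ((*v) (hess f (x + s *\<^sub>R axis i 1) - hess f x)) \<le> M * \<bar>s\<bar>"
      using assms unfolding LM_smooth_def by (metis add_diff_cancel_left' norm_axis_1 norm_scaleR mult.right_neutral)
    then have "norm ((hess f (x + s *\<^sub>R axis i 1) - hess f x) *v v) \<le> M * \<bar>s\<bar> * norm v"
      by (rule norm_matrix_vector_bound)
    moreover have "?Q s *v v = (1/s) *\<^sub>R ((hess f (x + s *\<^sub>R axis i 1) - hess f x) *v v)"
      by (simp only: scaleR_matrix_vector_assoc)
    ultimately show "norm (?Q s *v v) \<le> M * norm v"
      using \<open>s \<noteq> 0\<close> by (simp add: field_simps)
  qed
  ultimately show "norm (third f x i *v v) \<le> M * norm v"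
    using tendsto_upperbound[OF tendsto_norm] by fastforce
qed

lemma tendsto_onorm_matrix_zero:
  fixes X :: "'a \<Rightarrow> real^'n^'m"
  assumes "(X \<longlongrightarrow> 0) F"
  shows "((\<lambda>s. onorm ((*v) (X s))) \<longlongrightarrow> 0) F"
proof (rule Lim_null_comparison)
  show "\<forall>\<^sub>F s in F. norm (onorm ((*v) (X s))) \<le> (\<Sum>i\<in>UNIV. \<Sum>j\<in>UNIV. \<bar>X s $ i $ j\<bar>)"
    by (simp add: onorm_matrix_nonneg onorm_le_matrix_component_sum)
  have "((\<lambda>s. \<Sum>i\<in>UNIV. \<Sum>j\<in>UNIV. \<bar>X s $ i $ j\<bar>) \<longlongrightarrow> (\<Sum>i\<in>UNIV. \<Sum>j\<in>UNIV. \<bar>(0::real^'n^'m) $ i $ j\<bar>)) F"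
    by (intro tendsto_intros assms)
  then show "((\<lambda>s. \<Sum>i\<in>UNIV. \<Sum>j\<in>UNIV. \<bar>X s $ i $ j\<bar>) \<longlongrightarrow> 0) F" by simp
qed

lemma tendsto_matrix_zero_onorm:
  fixes X :: "'a \<Rightarrow> real^'n^'m"
  assumes "((\<lambda>s. onorm ((*v) (X s))) \<longlongrightarrow> 0) F"
  shows "(X \<longlongrightarrow> 0) F"
proof (rule vec_tendstoI, rule vec_tendstoI)
  fix i j
  have "((\<lambda>s. X s $ i $ j) \<longlongrightarrow> 0) F"
    by (rule Lim_null_comparison[OF always_eventually assms]) (simp add: matrix_component_le_onorm)
  then show "((\<lambda>s. X s $ i $ j) \<longlongrightarrow> 0 $ i $ j) F" by simp
qed

text \<open>The resolvent identity \<open>A(s)\<inverse> - A(0)\<inverse> = A(s)\<inverse> (A(0) - A(s)) A(0)\<inverse>\<close>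
  reduces both limits to the differentiability of \<open>A\<close>, given a uniform bound on \<open>A(s)\<inverse>\<close>.\<close>
lemma matrix_inv_difference_quotient_tendsto:
  fixes A :: "real \<Rightarrow> real^'n^'n"
  assumes inv: "\<And>s. invertible (A s)" and bound: "\<And>s. onorm ((*v) (matrix_inv (A s))) \<le> c"
    and dq: "((\<lambda>s. (1/s) *\<^sub>R (A s - A 0)) \<longlongrightarrow> A') (at 0)"
  shows "((\<lambda>s. matrix_inv (A s)) \<longlongrightarrow> matrix_inv (A 0)) (at 0)"
    and "((\<lambda>s. (1/s) *\<^sub>R (matrix_inv (A s) - matrix_inv (A 0)))
          \<longlongrightarrow> - (matrix_inv (A 0) ** (A' ** matrix_inv (A 0)))) (at 0)"
proof -
  define B where "B s = matrix_inv (A s)" for s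
  have resolvent: "B s - B 0 = - (B s ** ((A s - A 0) ** B 0))" for s
    using resolvent_identity[OF inv inv, of s 0] unfolding B_def
    by (metis minus_diff_eq matrix_mul_minus_left matrix_mul_minus_right)
  have "((\<lambda>s. A s - A 0) \<longlongrightarrow> 0) (at 0)"
    using tendsto_of_difference_quotient[OF dq] by (simp add: LIM_zero)
  then have "((\<lambda>s. c * (onorm ((*v) (A s - A 0)) * c)) \<longlongrightarrow> c * (0 * c)) (at 0)"
    by (intro tendsto_mult_left tendsto_mult_right tendsto_onorm_matrix_zero)
  then have majorant_lim: "((\<lambda>s. c * (onorm ((*v) (A s - A 0)) * c)) \<longlongrightarrow> 0) (at 0)"
    by simp
  have "onorm ((*v) (B s - B 0)) \<le> c * (onorm ((*v) (A s - A 0)) * c)" for s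
    unfolding resolvent onorm_matrix_uminus
    by (intro onorm_matrix_mul_bound order_refl) (simp_all add: B_def bound)
  then have majorant: "\<forall>s. norm (onorm ((*v) (B s - B 0))) \<le> c * (onorm ((*v) (A s - A 0)) * c)"
    by (simp add: onorm_matrix_nonneg)
  have "((\<lambda>s. B s - B 0) \<longlongrightarrow> 0) (at 0)"
    by (intro tendsto_matrix_zero_onorm Lim_null_comparison[OF always_eventually[OF majorant] majorant_lim])
  then show cont: "(B \<longlongrightarrow> B 0) (at 0)" by (rule LIM_zero_cancel)
  have "((\<lambda>s. - (B s ** ((1/s) *\<^sub>R (A s - A 0) ** B 0))) \<longlongrightarrow> - (B 0 ** (A' ** B 0))) (at 0)"
    by (intro tendsto_minus tendsto_matrix_mult cont dq tendsto_const)
  then show "((\<lambda>s. (1/s) *\<^sub>R (B s - B 0)) \<longlongrightarrow> - (B 0 ** (A' ** B 0))) (at 0)"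
    by (simp only: resolvent scaleR_minus_right scalar_matrix_assoc[symmetric] matrix_scalar_ac)
qed

lemma matrix_square_difference_quotient_tendsto:
  fixes B :: "real \<Rightarrow> real^'n^'n"
  assumes "(B \<longlongrightarrow> B 0) (at 0)" and "((\<lambda>s. (1/s) *\<^sub>R (B s - B 0)) \<longlongrightarrow> B') (at 0)"
  shows "((\<lambda>s. (1/s) *\<^sub>R (B s ** B s - B 0 ** B 0)) \<longlongrightarrow> B' ** B 0 + B 0 ** B') (at 0)"
proof -
  have "B s ** B s - B 0 ** B 0 = (B s - B 0) ** B s + B 0 ** (B s - B 0)" for s
    by (simp add: matrix_mul_diff_left matrix_mul_diff_right)
  moreover have "((\<lambda>s. ((1/s) *\<^sub>R (B s - B 0)) ** B s + B 0 ** ((1/s) *\<^sub>R (B s - B 0)))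
      \<longlongrightarrow> B' ** B 0 + B 0 ** B') (at 0)"
    by (intro tendsto_add tendsto_matrix_mult assms tendsto_const)
  ultimately show ?thesis
    by (simp add: scalar_matrix_assoc matrix_scalar_ac scaleR_add_right)
qed

locale smooth_potential_step =
  fixes f :: "real^'n \<Rightarrow> real" and L M t :: real
  assumes smooth: "LM_smooth f L M" and t_nonneg: "0 \<le> t" and step_le: "8 * L * t \<le> 1"
begin

abbreviation resolvent :: "real^'n \<Rightarrow> real^'n^'n" where
  "resolvent y \<equiv> matrix_inv (mat 1 + t *\<^sub>R hess f y)"

lemma thrice_diff: "thrice_differentiable f"
  using smooth by (simp add: LM_smooth_def)

lemma onorm_hess_le: "onorm ((*v) (hess f y)) \<le> L"
  using smooth by (simp add: LM_smooth_def)

lemma L_nonneg: "0 \<le> L"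
  using onorm_matrix_nonneg onorm_hess_le by (rule order_trans)

lemma M_nonneg: "0 \<le> M"
  using onorm_matrix_nonneg onorm_third_le[OF smooth] by (rule order_trans)

lemma onorm_step_hess_le: "onorm ((*v) (t *\<^sub>R hess f y)) \<le> 1/8"
proof -
  have "onorm ((*v) (t *\<^sub>R hess f y)) \<le> t * L"
    using onorm_hess_le t_nonneg by (simp add: onorm_matrix_scaleR mult_left_mono)
  also have "\<dots> \<le> 1/8" using step_le by (simp add: field_simps)
  finally show ?thesis .
qed

lemma transpose_step_hess: "transpose (t *\<^sub>R hess f y) = t *\<^sub>R hess f y"
  by (simp add: transpose_scalar transpose_hess[OF thrice_diff])

lemma invertible_step: "invertible (mat 1 + t *\<^sub>R hess f y)"
  by (rule invertible_perturbed_identity[OF onorm_step_hess_le]) simp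

lemma onorm_resolvent_le: "onorm ((*v) (resolvent y)) \<le> 8/7"
  using onorm_inv_perturbed_identity[OF onorm_step_hess_le] by simp

lemma pos_def_resolvent: "pos_def (resolvent y)"
  by (rule pos_def_inv_perturbed_identity[OF onorm_step_hess_le _ transpose_step_hess]) simp

lemma Gmat_eq: "Gmat f t y = resolvent y ** resolvent y"
  by (simp add: Gmat_def)

lemma pd_sqrt_Gmat: "pd_sqrt (Gmat f t y) = resolvent y"
  by (simp add: Gmat_eq pd_sqrt_square pos_def_resolvent)

lemma quadratic_form_Gmat: "v \<bullet> (Gmat f t y *v v) = (norm (resolvent y *v v))\<^sup>2"
  using pos_def_resolvent unfolding Gmat_eq pos_def_def by (simp add: quadratic_form_square_symmetric)

lemma onorm_Gmat_le: "onorm ((*v) (Gmat f t y)) \<le> 64/49"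
  using onorm_matrix_mul_bound[OF onorm_resolvent_le onorm_resolvent_le] by (simp add: Gmat_eq)

text \<open>\<open>64/81 \<ge> 3/4\<close> and \<open>64/49 \<le> 4/3\<close>: the resolvent is squeezed between \<open>8/9\<close> and \<open>8/7\<close>.\<close>
lemma Gmat_loewner_lower: "loewner_le ((3/4) *\<^sub>R mat 1) (Gmat f t y)"
  unfolding loewner_le_def
proof
  fix v :: "real^'n"
  have bound: "norm v \<le> 9/8 * norm (resolvent y *v v)"
    using norm_le_inv_perturbed_identity[OF onorm_step_hess_le] by simp
  have "norm v * norm v \<le> 81/64 * (norm (resolvent y *v v) * norm (resolvent y *v v))"
    using mult_mono[OF bound bound] by (simp add: algebra_simps)
  then show "v \<bullet> ((3/4) *\<^sub>R mat 1 *v v) \<le> v \<bullet> (Gmat f t y *v v)"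
    unfolding quadratic_form_scalar_matrix quadratic_form_Gmat power2_eq_square
    using zero_le_square[of "norm (resolvent y *v v)"] by linarith
qed

lemma Gmat_loewner_upper: "loewner_le (Gmat f t y) ((4/3) *\<^sub>R mat 1)"
  unfolding loewner_le_def
proof
  fix v :: "real^'n"
  have bound: "norm (resolvent y *v v) \<le> 8/7 * norm v"
    by (rule norm_matrix_vector_bound[OF onorm_resolvent_le])
  have "norm (resolvent y *v v) * norm (resolvent y *v v) \<le> 64/49 * (norm v * norm v)"
    using mult_mono[OF bound bound] by (simp add: algebra_simps)
  then show "v \<bullet> (Gmat f t y *v v) \<le> v \<bullet> ((4/3) *\<^sub>R mat 1 *v v)"
    unfolding quadratic_form_scalar_matrix quadratic_form_Gmat power2_eq_square
    using zero_le_square[of "norm v"] by linarith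
qed

definition resolvent_partial :: "real^'n \<Rightarrow> 'n \<Rightarrow> real^'n^'n" where
  "resolvent_partial x k = - (resolvent x ** ((t *\<^sub>R third f x k) ** resolvent x))"

definition Gmat_partial :: "real^'n \<Rightarrow> 'n \<Rightarrow> real^'n^'n" where
  "Gmat_partial x k = resolvent_partial x k ** resolvent x + resolvent x ** resolvent_partial x k"

lemma Gmat_difference_quotient_tendsto:
  "((\<lambda>s. (1/s) *\<^sub>R (Gmat f t (x + s *\<^sub>R axis k 1) - Gmat f t x)) \<longlongrightarrow> Gmat_partial x k) (at 0)"
proof -
  define A where "A s = mat 1 + t *\<^sub>R hess f (x + s *\<^sub>R axis k 1)" for s
  have "(\<lambda>s. (1/s) *\<^sub>R (A s - A 0))
      = (\<lambda>s. t *\<^sub>R ((1/s) *\<^sub>R (hess f (x + s *\<^sub>R axis k 1) - hess f x)))"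
    by (simp add: A_def fun_eq_iff algebra_simps)
  moreover have "((\<lambda>s. t *\<^sub>R ((1/s) *\<^sub>R (hess f (x + s *\<^sub>R axis k 1) - hess f x)))
      \<longlongrightarrow> t *\<^sub>R third f x k) (at 0)"
    by (intro tendsto_scaleR tendsto_const hess_difference_quotient_tendsto thrice_diff)
  ultimately have "((\<lambda>s. (1/s) *\<^sub>R (A s - A 0)) \<longlongrightarrow> t *\<^sub>R third f x k) (at 0)"
    by simp
  moreover have "invertible (A s)" "onorm ((*v) (matrix_inv (A s))) \<le> 8/7" for s
    unfolding A_def by (rule invertible_step, rule onorm_resolvent_le)
  ultimately have "((\<lambda>s. matrix_inv (A s)) \<longlongrightarrow> matrix_inv (A 0)) (at 0)"
      and "((\<lambda>s. (1/s) *\<^sub>R (matrix_inv (A s) - matrix_inv (A 0))) \<longlongrightarrow> resolvent_partial x k) (at 0)"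
    using matrix_inv_difference_quotient_tendsto[of A "8/7" "t *\<^sub>R third f x k"]
    by (simp_all add: A_def resolvent_partial_def)
  from matrix_square_difference_quotient_tendsto[OF this] show ?thesis
    by (simp add: A_def Gmat_eq Gmat_partial_def)
qed

lemma mdiv_Gmat: "mdiv (Gmat f t) x = (\<Sum>k\<in>UNIV. Gmat_partial x k *v axis k 1)"
  by (simp add: vec_eq_iff mdiv_def sum_component matrix_vector_mult_axis
      partial_entry_eq_limit[OF Gmat_difference_quotient_tendsto])

lemma onorm_step_third_le: "onorm ((*v) (t *\<^sub>R third f x k)) \<le> t * M"
  using onorm_third_le[OF smooth] t_nonneg by (simp add: onorm_matrix_scaleR mult_left_mono)

lemma onorm_resolvent_partial_le: "onorm ((*v) (resolvent_partial x k)) \<le> 8/7 * (t * M * (8/7))"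
  unfolding resolvent_partial_def onorm_matrix_uminus
  by (intro onorm_matrix_mul_bound onorm_resolvent_le onorm_step_third_le)

lemma onorm_Gmat_partial_le: "onorm ((*v) (Gmat_partial x k)) \<le> 2 * (8/7)^3 * (t * M)"
proof -
  have "onorm ((*v) (Gmat_partial x k))
      \<le> 8/7 * (t * M * (8/7)) * (8/7) + 8/7 * (8/7 * (t * M * (8/7)))"
    unfolding Gmat_partial_def
    by (intro order_trans[OF onorm_matrix_add_le] add_mono onorm_matrix_mul_bound
        onorm_resolvent_le onorm_resolvent_partial_le)
  then show ?thesis by (simp add: power3_eq_cube algebra_simps)
qed

lemma norm_mdiv_Gmat_le: "norm (mdiv (Gmat f t) x) \<le> real CARD('n) * (2 * (8/7)^3 * (t * M))"
proof -
  have "norm (mdiv (Gmat f t) x) \<le> (\<Sum>k\<in>UNIV. norm (Gmat_partial x k *v axis k 1))"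
    unfolding mdiv_Gmat by (rule norm_sum)
  also have "\<dots> \<le> (\<Sum>k\<in>(UNIV::'n set). 2 * (8/7)^3 * (t * M))"
  proof (rule sum_mono)
    fix k
    show "norm (Gmat_partial x k *v axis k 1) \<le> 2 * (8/7)^3 * (t * M)"
      using norm_matrix_vector_bound[OF onorm_Gmat_partial_le, of x k "axis k 1"] by simp
  qed
  finally show ?thesis by simp
qed

lemma norm_tr3_Gmat_le:
  "norm (tr3 f x (Gmat f t x)) \<le> sqrt (real CARD('n)) * (real CARD('n) * (M * (64/49)))"
proof (rule norm_le_sqrt_card_if_components_le)
  fix i
  have "onorm ((*v) (third f x i ** Gmat f t x)) \<le> M * (64/49)"
    by (intro onorm_matrix_mul_bound onorm_third_le[OF smooth] onorm_Gmat_le)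
  then show "\<bar>tr3 f x (Gmat f t x) $ i\<bar> \<le> real CARD('n) * (M * (64/49))"
    unfolding tr3_def vec_lambda_beta
    by (rule order_trans[OF abs_trace_le_onorm mult_left_mono]) simp
qed

lemma norm_drift_le:
  "norm (t *\<^sub>R (hess f x *v (Gmat f t x *v grad f x))) \<le> 4/3 * (t * L * norm (grad f x))"
proof -
  have "norm (hess f x *v (Gmat f t x *v grad f x)) \<le> L * (64/49) * norm (grad f x)"
    unfolding matrix_vector_mul_assoc
    by (intro norm_matrix_vector_bound onorm_matrix_mul_bound onorm_hess_le onorm_Gmat_le)
  also have "\<dots> \<le> 4/3 * (L * norm (grad f x))"
    using L_nonneg by (simp add: mult_nonneg_nonneg)
  finally have "t * norm (hess f x *v (Gmat f t x *v grad f x)) \<le> t * (4/3 * (L * norm (grad f x)))"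
    using t_nonneg by (rule mult_left_mono)
  then show ?thesis
    using t_nonneg by (simp add: mult_ac)
qed

lemma norm_correction_le:
  "norm (t *\<^sub>R (pd_sqrt (Gmat f t x) *v tr3 f x (Gmat f t x)))
     \<le> 512/343 * (t * M * (real CARD('n) * sqrt (real CARD('n))))"
proof -
  have "norm (resolvent x *v tr3 f x (Gmat f t x)) \<le> 8/7 * norm (tr3 f x (Gmat f t x))"
    by (rule norm_matrix_vector_bound[OF onorm_resolvent_le])
  also have "\<dots> \<le> 8/7 * (sqrt (real CARD('n)) * (real CARD('n) * (M * (64/49))))"
    by (intro mult_left_mono norm_tr3_Gmat_le) simp
  finally have "t * norm (resolvent x *v tr3 f x (Gmat f t x))
      \<le> t * (8/7 * (sqrt (real CARD('n)) * (real CARD('n) * (M * (64/49)))))"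
    using t_nonneg by (rule mult_left_mono)
  then show ?thesis
    using t_nonneg by (simp add: pd_sqrt_Gmat mult_ac)
qed

lemma norm_mu_tilde_le:
  "norm (mu_tilde f t x)
     \<le> (4/3) * t * L * norm (grad f x) + 6 * t * real CARD('n) powr (3/2) * M"
proof -
  define n where "n = real CARD('n)"
  define P where "P = t * M * (n * sqrt n)"
  define drift where "drift = t *\<^sub>R (hess f x *v (Gmat f t x *v grad f x))"
  define correction where "correction = t *\<^sub>R (pd_sqrt (Gmat f t x) *v tr3 f x (Gmat f t x))"
  have "0 \<le> t * M * n" using t_nonneg M_nonneg by (simp add: n_def)
  then have "t * M * n * 1 \<le> t * M * n * sqrt n"
    by (rule mult_left_mono[rotated]) (simp add: n_def)
  then have "t * M * n \<le> P" and "0 \<le> P"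
    using \<open>0 \<le> t * M * n\<close> by (simp_all add: P_def mult.assoc)
  have "norm (mdiv (Gmat f t) x) \<le> 1024/343 * (t * M * n)"
    using norm_mdiv_Gmat_le by (simp add: n_def power3_eq_cube mult_ac)
  with \<open>t * M * n \<le> P\<close> have divergence_le: "norm (mdiv (Gmat f t) x) \<le> 1024/343 * P"
    by linarith
  have "norm (mu_tilde f t x) \<le> norm drift + norm correction + norm (mdiv (Gmat f t) x)"
    unfolding mu_tilde_def drift_def[symmetric] correction_def[symmetric]
    using norm_triangle_ineq4[of "- drift" correction]
      norm_triangle_ineq4[of "- drift - correction" "mdiv (Gmat f t) x"]
    by simp
  also have "\<dots> \<le> 4/3 * (t * L * norm (grad f x)) + 6 * P"
    using norm_drift_le[of x] norm_correction_le[of x] divergence_le \<open>0 \<le> P\<close>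
    unfolding drift_def correction_def P_def n_def by linarith
  also have "\<dots> = (4/3) * t * L * norm (grad f x) + 6 * t * real CARD('n) powr (3/2) * M"
    using powr_add[of n 1 "1/2"] by (simp add: P_def n_def powr_half_sqrt mult_ac)
  finally show ?thesis .
qed

end

theorem lemma5:
  fixes f :: "real^'n \<Rightarrow> real" and L M t :: real
  assumes "LM_smooth f L M"
    and "0 \<le> t" and "8 * L * t \<le> 1" and "M * t \<le> 1"
  shows "\<forall>x. loewner_le ((3/4) *\<^sub>R mat 1) (Gmat f t x)
            \<and> loewner_le (Gmat f t x) ((4/3) *\<^sub>R mat 1)
            \<and> norm (mu_tilde f t x)
                \<le> (4/3) * t * L * norm (grad f x) + 6 * t * real CARD('n) powr (3/2) * M"
proof -
  interpret smooth_potential_step f L M t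
    using assms(1-3) by unfold_locales
  show ?thesis
    using Gmat_loewner_lower Gmat_loewner_upper norm_mu_tilde_le by blast
qed

end
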